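(* Let $\mathfrak g$ be a unimodular Lie algebra. Then every proper LCP structure $(g,\theta,\mathfrak u)$ on $\mathfrak g$ is adapted, i.e. $\theta|_{\mathfrak u}=0$.
   Context: All Lie algebras are real and finite-dimensional. Let $\mathfrak g$ be a Lie algebra with an inner product $g$. For $x\in\mathfrak g$, $\nabla^g_x\in\mathfrak{so}(\mathfrak g)$ is given by $g(\nabla^g_xy,z)=\frac12\big(g([x,y],z)-g([x,z],y)-g([y,z],x)\big)$. For $\theta\in\mathfrak g^*$ with $g$-dual vector $\theta^\sharp$, set $\nabla^\theta_xy:=\nabla^g_xy+\theta(x)y+\theta(y)x-g(x,y)\theta^\sharp$. A 1-form $\theta\in\mathfrak g^*$ is closed if it vanishes on $\mathfrak g'=[\mathfrak g,\mathfrak g]$. A subspace $\mathfrak u\subset\mathfrak g$ is $\nabla^\theta$-flat if $\nabla^\theta_x\mathfrak u\subset\mathfrak u$ for all $x\in\mathfrak g$ and $x\mapsto\nabla^\theta_x|_{\mathfrak u}$ is a Lie algebra representation $\mathfrak g\to\mathfrak{gl}(\mathfrak u)$. An LCP structure on $\mathfrak g$ is a triple $(g,\theta,\mathfrak u)$ with $g$ an inner product, $\theta\ne0$ a closed 1-form and $\mathfrak u\neq0$ a $\nabla^\theta$-flat subspace. It is proper if $\mathfrak u\subsetneq\mathfrak g$, and adapted if $\theta|_{\mathfrak u}=0$. A Lie algebra $\mathfrak g$ is unimodular if $\mathrm{tr}(\mathrm{ad}_x)=0$ for all $x\in\mathfrak g$. *)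

theory Defs
  imports "HOL-Analysis.Analysis"
begin

section \<open>Finite-dimensional real Lie algebras\<close>

text \<open>The underlying vector space is the whole type, a real vector space that carries no
  preferred inner product.\<close>

locale lie_algebra =
  fixes br :: "'a::real_vector \<Rightarrow> 'a \<Rightarrow> 'a"
  assumes finite_dim: "\<exists>B::'a set. finite B \<and> span B = UNIV"
    and bilinear_br: "bilinear br"
    and br_self: "br x x = 0"
    and jacobi: "br x (br y z) + br y (br z x) + br z (br x y) = 0"

definition derived_algebra :: "('a::real_vector \<Rightarrow> 'a \<Rightarrow> 'a) \<Rightarrow> 'a set" where
  "derived_algebra br = span {br x y | x y. True}"

text \<open>The trace of an endomorphism of a finite-dimensional space, computed in a chosen basis;
  by \<open>lin_trace_eq\<close> below the choice does not matter.\<close>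

definition lin_trace :: "('a::real_vector \<Rightarrow> 'a) \<Rightarrow> real" where
  "lin_trace f = (let B = (SOME B. finite B \<and> independent B \<and> span B = UNIV)
                  in \<Sum>b\<in>B. representation B (f b) b)"

definition unimodular :: "('a::real_vector \<Rightarrow> 'a \<Rightarrow> 'a) \<Rightarrow> bool" where
  "unimodular br \<longleftrightarrow> (\<forall>x. lin_trace (br x) = 0)"

definition lie_rep_on ::
  "('a::real_vector \<Rightarrow> 'a \<Rightarrow> 'a) \<Rightarrow> 'b::real_vector set \<Rightarrow> ('a \<Rightarrow> 'b \<Rightarrow> 'b) \<Rightarrow> bool" where
  "lie_rep_on br u \<rho> \<longleftrightarrow>
     subspace u \<and>
     (\<forall>x. \<forall>w\<in>u. \<rho> x w \<in> u) \<and>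
     (\<forall>x. \<forall>v\<in>u. \<forall>w\<in>u. \<rho> x (v + w) = \<rho> x v + \<rho> x w) \<and>
     (\<forall>x c. \<forall>w\<in>u. \<rho> x (c *\<^sub>R w) = c *\<^sub>R \<rho> x w) \<and>
     (\<forall>x y. \<forall>w\<in>u. \<rho> (x + y) w = \<rho> x w + \<rho> y w) \<and>
     (\<forall>c x. \<forall>w\<in>u. \<rho> (c *\<^sub>R x) w = c *\<^sub>R \<rho> x w) \<and>
     (\<forall>x y. \<forall>w\<in>u. \<rho> (br x y) w = \<rho> x (\<rho> y w) - \<rho> y (\<rho> x w))"

section \<open>Inner products and Weyl connections\<close>

definition inner_product :: "('a::real_vector \<Rightarrow> 'a \<Rightarrow> real) \<Rightarrow> bool" where
  "inner_product g \<longleftrightarrow> bilinear g \<and> (\<forall>x y. g x y = g y x) \<and> (\<forall>x. x \<noteq> 0 \<longrightarrow> g x x > 0)"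

text \<open>The descriptions in the next two definitions have unique solutions when \<open>g\<close> is an inner
  product on a finite-dimensional space; see \<open>levi_civita_eq\<close> and \<open>sharp_eq\<close> below.\<close>

definition levi_civita ::
  "('a::real_vector \<Rightarrow> 'a \<Rightarrow> 'a) \<Rightarrow> ('a \<Rightarrow> 'a \<Rightarrow> real) \<Rightarrow> 'a \<Rightarrow> 'a \<Rightarrow> 'a" where
  "levi_civita br g x y =
     (THE v. \<forall>z. g v z = (1/2) * (g (br x y) z - g (br x z) y - g (br y z) x))"

definition sharp :: "('a::real_vector \<Rightarrow> 'a \<Rightarrow> real) \<Rightarrow> ('a \<Rightarrow> real) \<Rightarrow> 'a" where
  "sharp g \<theta> = (THE v. \<forall>z. g v z = \<theta> z)"

definition weyl_connection ::
  "('a::real_vector \<Rightarrow> 'a \<Rightarrow> 'a) \<Rightarrow> ('a \<Rightarrow> 'a \<Rightarrow> real) \<Rightarrow> ('a \<Rightarrow> real) \<Rightarrow> 'a \<Rightarrow> 'a \<Rightarrow> 'a" where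
  "weyl_connection br g \<theta> x y =
     levi_civita br g x y + \<theta> x *\<^sub>R y + \<theta> y *\<^sub>R x - g x y *\<^sub>R sharp g \<theta>"

section \<open>LCP structures\<close>

definition closed_form :: "('a::real_vector \<Rightarrow> 'a \<Rightarrow> 'a) \<Rightarrow> ('a \<Rightarrow> real) \<Rightarrow> bool" where
  "closed_form br \<theta> \<longleftrightarrow> linear \<theta> \<and> (\<forall>x \<in> derived_algebra br. \<theta> x = 0)"

definition flat_subspace ::
  "('a::real_vector \<Rightarrow> 'a \<Rightarrow> 'a) \<Rightarrow> ('a \<Rightarrow> 'a \<Rightarrow> real) \<Rightarrow> ('a \<Rightarrow> real) \<Rightarrow> 'a set \<Rightarrow> bool" where
  "flat_subspace br g \<theta> u \<longleftrightarrow> lie_rep_on br u (weyl_connection br g \<theta>)"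

definition LCP_structure ::
  "('a::real_vector \<Rightarrow> 'a \<Rightarrow> 'a) \<Rightarrow> ('a \<Rightarrow> 'a \<Rightarrow> real) \<Rightarrow> ('a \<Rightarrow> real) \<Rightarrow> 'a set \<Rightarrow> bool" where
  "LCP_structure br g \<theta> u \<longleftrightarrow>
     inner_product g \<and>
     closed_form br \<theta> \<and> \<theta> \<noteq> (\<lambda>x. 0) \<and>
     flat_subspace br g \<theta> u \<and> u \<noteq> {0}"

definition proper_LCP ::
  "('a::real_vector \<Rightarrow> 'a \<Rightarrow> 'a) \<Rightarrow> ('a \<Rightarrow> 'a \<Rightarrow> real) \<Rightarrow> ('a \<Rightarrow> real) \<Rightarrow> 'a set \<Rightarrow> bool" where
  "proper_LCP br g \<theta> u \<longleftrightarrow> LCP_structure br g \<theta> u \<and> u \<subset> UNIV"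

definition adapted_LCP ::
  "('a::real_vector \<Rightarrow> 'a \<Rightarrow> 'a) \<Rightarrow> ('a \<Rightarrow> 'a \<Rightarrow> real) \<Rightarrow> ('a \<Rightarrow> real) \<Rightarrow> 'a set \<Rightarrow> bool" where
  "adapted_LCP br g \<theta> u \<longleftrightarrow> LCP_structure br g \<theta> u \<and> (\<forall>w\<in>u. \<theta> w = 0)"

section \<open>Well-definedness\<close>

lemma lin_trace_eq:
  fixes f :: "'a::real_vector \<Rightarrow> 'a"
  assumes f: "linear f" and C: "finite C" "independent C" "span C = UNIV"
  shows "lin_trace f = (\<Sum>c\<in>C. representation C (f c) c)"
proof -
  define B where "B = (SOME B::'a set. finite B \<and> independent B \<and> span B = UNIV)"
  have B: "finite B" "independent B" "span B = UNIV"
    using someI[of "\<lambda>B::'a set. finite B \<and> independent B \<and> span B = UNIV" C] C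
    unfolding B_def by auto
  have expand: "(\<Sum>b\<in>S. representation S v b *\<^sub>R b) = v"
    if "finite S" "independent S" "span S = UNIV" for S and v :: 'a
    using sum_representation_eq[of S v S] that by auto
  have "(\<Sum>b\<in>B. representation B (f b) b)
        = (\<Sum>b\<in>B. \<Sum>c\<in>C. representation C b c * representation B (f c) b)"
  proof (rule sum.cong[OF refl])
    fix b assume "b \<in> B"
    have "f b = (\<Sum>c\<in>C. representation C b c *\<^sub>R f c)"
      using arg_cong[OF expand[OF C, of b], of f] f by (simp add: linear_sum linear_scale)
    then show "representation B (f b) b
               = (\<Sum>c\<in>C. representation C b c * representation B (f c) b)"
      using B by (simp add: representation_sum representation_scale)
  qed
  also have "\<dots> = (\<Sum>c\<in>C. \<Sum>b\<in>B. representation B (f c) b * representation C b c)"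
    by (subst sum.swap) (simp add: mult.commute)
  also have "\<dots> = (\<Sum>c\<in>C. representation C (\<Sum>b\<in>B. representation B (f c) b *\<^sub>R b) c)"
    using C by (simp add: representation_sum representation_scale)
  also have "\<dots> = (\<Sum>c\<in>C. representation C (f c) c)"
    by (simp add: expand[OF B])
  finally show ?thesis
    by (simp add: lin_trace_def B_def[symmetric])
qed

lemma inner_product_eqI:
  assumes g: "inner_product g" and eq: "\<And>z. g v z = g w z"
  shows "v = w"
proof (rule ccontr)
  assume "v \<noteq> w"
  then have "g (v - w) (v - w) > 0"
    using g by (simp add: inner_product_def)
  moreover have "g (v - w) (v - w) = 0"
    using g eq[of "v - w"] bilinear_lsub[of g v w "v - w"] by (simp add: inner_product_def)
  ultimately show False by simp
qed

lemma riesz_on_span: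
  fixes g :: "'a::real_vector \<Rightarrow> 'a \<Rightarrow> real"
  assumes g: "inner_product g" and "finite B" and "linear f"
  shows "\<exists>v\<in>span B. \<forall>z\<in>span B. g v z = f z"
  using \<open>finite B\<close> \<open>linear f\<close>
proof (induction B arbitrary: f rule: finite_induct)
  case empty
  then show ?case
    using g by (auto simp: inner_product_def bilinear_lzero linear_0)
next
  case (insert a B)
  have bil: "bilinear g" and sym: "\<And>x y. g x y = g y x" and pos: "\<And>x. x \<noteq> 0 \<Longrightarrow> g x x > 0"
    using g by (auto simp: inner_product_def)
  note rules = bilinear_ladd[OF bil] bilinear_radd[OF bil] bilinear_lmul[OF bil]
    bilinear_rmul[OF bil] bilinear_lsub[OF bil] bilinear_rsub[OF bil] bilinear_rzero[OF bil]
    bilinear_lzero[OF bil]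
  have "linear (g a)" using bil by (auto simp: bilinear_def)
  then obtain p where p: "p \<in> span B" "\<And>z. z \<in> span B \<Longrightarrow> g p z = g a z"
    using insert.IH by blast
  obtain v where v: "v \<in> span B" "\<And>z. z \<in> span B \<Longrightarrow> g v z = f z"
    using insert.IH[OF insert.prems] by blast
  define b where "b = a - p"
  have orth: "g b z = 0" "g z b = 0" if "z \<in> span B" for z
    using p that sym[of z b] by (auto simp: b_def rules)
  define w where "w = v + (f b / g b b) *\<^sub>R b"
  have b_in: "b \<in> span (insert a B)"
    unfolding b_def using p(1) span_mono[OF subset_insertI[of B a]]
    by (intro span_diff) (auto intro: span_base)
  have w_in: "w \<in> span (insert a B)"
    unfolding w_def using v(1) span_mono[of B "insert a B"] b_in
    by (intro span_add span_scale) auto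
  have w_b: "g w b = f b"
    using orth(2)[OF v(1)] pos[of b] linear_0[OF insert.prems]
    by (cases "b = 0") (auto simp: w_def rules)
  have "g w z = f z" if z: "z \<in> span (insert a B)" for z
  proof -
    obtain k where k: "z - k *\<^sub>R a \<in> span B"
      using z by (auto simp: span_insert)
    define y where "y = z - k *\<^sub>R a + k *\<^sub>R p"
    have y: "y \<in> span B" unfolding y_def using k p(1) by (intro span_add span_scale)
    have z_eq: "z = y + k *\<^sub>R b" by (simp add: y_def b_def algebra_simps)
    have "g w y = f y" using v(2)[OF y] orth(1)[OF y] by (simp add: w_def rules)
    with w_b show ?thesis
      using insert.prems by (simp add: z_eq rules linear_add linear_scale)
  qed
  with w_in show ?case by blast
qed

lemma sharp_eq:
  fixes g :: "'a::real_vector \<Rightarrow> 'a \<Rightarrow> real"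
  assumes "\<exists>B::'a set. finite B \<and> span B = UNIV" "inner_product g" "linear \<theta>"
  shows "g (sharp g \<theta>) z = \<theta> z"
proof -
  obtain v where v: "\<And>z. g v z = \<theta> z"
    using riesz_on_span[of g _ \<theta>] assms by (metis UNIV_I)
  have "sharp g \<theta> = v"
    unfolding sharp_def
    by (rule the_equality) (auto simp: v intro: inner_product_eqI[OF assms(2)])
  with v show ?thesis by simp
qed

lemma (in lie_algebra) levi_civita_eq:
  assumes g: "inner_product g"
  shows "g (levi_civita br g x y) z = (1/2) * (g (br x y) z - g (br x z) y - g (br y z) x)"
proof -
  have bil: "bilinear g" using g by (simp add: inner_product_def)
  have "linear (\<lambda>z. (1/2) * (g (br x y) z - g (br x z) y - g (br y z) x))"
    by (rule linearI)
      (simp_all add: bilinear_radd[OF bil] bilinear_ladd[OF bil] bilinear_rmul[OF bil]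
        bilinear_lmul[OF bil] bilinear_radd[OF bilinear_br] bilinear_rmul[OF bilinear_br]
        algebra_simps)
  from sharp_eq[OF finite_dim g this] show ?thesis
    by (simp add: sharp_def levi_civita_def)
qed

end

theory Submission
  imports Defs
begin

text \<open>Write \<open>D\<close> for the Weyl connection, \<open>n = dim \<gg>\<close> and \<open>q = dim u < n\<close>. Since \<open>D\<close> is torsion-free
  and \<open>D\<^sub>x - \<theta>(x)\<close> is skew, unimodularity reads \<open>tr R\<^sub>x = n \<theta>(x)\<close> for \<open>x \<in> u\<close>, where \<open>R\<^sub>x\<close> is the
  endomorphism \<open>y \<mapsto> D\<^sub>y x\<close> of \<open>u\<close>. Let \<open>t \<in> u\<close> be dual to \<open>\<theta>\<close> restricted to \<open>u\<close>, with
  \<open>c = \<theta>(t)\<close>. Closedness of \<open>\<theta>\<close> makes \<open>R\<^sub>t\<close> symmetric, and flatness gives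
  \<open>tr R\<^sub>t\<^sup>2 = tr R\<^sub>z\<close> with \<open>z = D\<^sub>t t\<close> and \<open>\<theta>(z) = c\<^sup>2\<close>. The Cauchy--Schwarz inequality
  \<open>(tr R\<^sub>t)\<^sup>2 \<le> q tr R\<^sub>t\<^sup>2\<close> becomes \<open>n\<^sup>2 c\<^sup>2 \<le> q n c\<^sup>2\<close>, which forces \<open>c = 0\<close>.\<close>

section \<open>Orthonormal bases\<close>

text \<open>The form \<open>g\<close> is a parameter because the type carries no inner product of
  its own.\<close>

definition orthonormal :: "('a::real_vector \<Rightarrow> 'a \<Rightarrow> real) \<Rightarrow> 'a set \<Rightarrow> bool" where
  "orthonormal g B \<longleftrightarrow> (\<forall>a\<in>B. \<forall>b\<in>B. g a b = (if a = b then 1 else 0))"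

lemma orthonormal_subset: "orthonormal g C \<Longrightarrow> B \<subseteq> C \<Longrightarrow> orthonormal g B"
  unfolding orthonormal_def by (meson subsetD)

lemma inner_product_sum_left:
  assumes "inner_product g"
  shows "g (\<Sum>i\<in>I. f i) y = (\<Sum>i\<in>I. g (f i) y)"
proof -
  have "linear (\<lambda>x. g x y)"
    using assms by (simp add: inner_product_def bilinear_def)
  then show ?thesis by (rule linear_sum)
qed

lemma inner_product_sum_right:
  assumes "inner_product g"
  shows "g y (\<Sum>i\<in>I. f i) = (\<Sum>i\<in>I. g y (f i))"
  using inner_product_sum_left[OF assms] assms by (simp add: inner_product_def)

lemma orthonormal_coeff:
  assumes g: "inner_product g" and B: "finite B" "orthonormal g B" and b: "b \<in> B"
  shows "g (\<Sum>a\<in>B. k a *\<^sub>R a) b = k b"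
proof -
  have bil: "bilinear g" using g by (simp add: inner_product_def)
  have "g (\<Sum>a\<in>B. k a *\<^sub>R a) b = (\<Sum>a\<in>B. k a * g a b)"
    by (simp add: inner_product_sum_left[OF g] bilinear_lmul[OF bil])
  also have "\<dots> = (\<Sum>a\<in>B. if a = b then k a else 0)"
    using B(2) b by (intro sum.cong) (auto simp: orthonormal_def)
  finally show ?thesis using B(1) b by simp
qed

lemma orthonormal_independent:
  assumes g: "inner_product g" and B: "finite B" "orthonormal g B"
  shows "independent B"
proof (subst independent_explicit_finite_subsets, intro allI impI ballI)
  fix A k b
  assume A: "A \<subseteq> B" "finite A" and sum0: "(\<Sum>a\<in>A. k a *\<^sub>R a) = 0" and b: "b \<in> A"
  have "orthonormal g A" using B(2) A(1) by (rule orthonormal_subset)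
  from orthonormal_coeff[OF g A(2) this b, of k] sum0 show "k b = 0"
    using g by (simp add: inner_product_def bilinear_lzero)
qed

lemma orthonormal_representation:
  assumes g: "inner_product g" and B: "finite B" "orthonormal g B" and v: "v \<in> span B"
    and b: "b \<in> B"
  shows "representation B v b = g v b"
proof -
  have "v = (\<Sum>a\<in>B. representation B v a *\<^sub>R a)"
    using sum_representation_eq[OF orthonormal_independent[OF g B] v B(1)] by simp
  with orthonormal_coeff[OF g B b, of "representation B v"] show ?thesis by simp
qed

lemma orthonormal_expansion:
  assumes g: "inner_product g" and B: "finite B" "orthonormal g B" and v: "v \<in> span B"
  shows "(\<Sum>b\<in>B. g v b *\<^sub>R b) = v"
proof -
  have "(\<Sum>b\<in>B. representation B v b *\<^sub>R b) = v"
    using sum_representation_eq[OF orthonormal_independent[OF g B] v B(1)] by simp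
  then show ?thesis
    by (simp add: orthonormal_representation[OF g B v])
qed

text \<open>Only \<open>v\<close> has to lie in \<open>span B\<close>; leaving \<open>w\<close> free
  lets \<open>w\<close> be a basis vector orthogonal to \<open>B\<close>.\<close>

lemma orthonormal_parseval:
  assumes g: "inner_product g" and B: "finite B" "orthonormal g B" and v: "v \<in> span B"
  shows "g w v = (\<Sum>b\<in>B. g w b * g v b)"
proof -
  have bil: "bilinear g" using g by (simp add: inner_product_def)
  have "g w v = g w (\<Sum>b\<in>B. g v b *\<^sub>R b)"
    by (simp add: orthonormal_expansion[OF g B v])
  also have "\<dots> = (\<Sum>b\<in>B. g w b * g v b)"
    by (simp add: inner_product_sum_right[OF g] bilinear_rmul[OF bil] mult.commute)
  finally show ?thesis .
qed

text \<open>Gram-Schmidt, one vector of \<open>S\<close> at a time. Vectors already spanned are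
  dropped, and \<open>B\<close> is kept untouched so that a basis of a subspace can be
  completed.\<close>

lemma orthonormal_extend:
  assumes g: "inner_product g" and B: "finite B" "orthonormal g B" and "finite S"
  shows "\<exists>C. finite C \<and> B \<subseteq> C \<and> orthonormal g C \<and> span C = span (B \<union> S)"
  using \<open>finite S\<close>
proof (induction S rule: finite_induct)
  case empty
  with B show ?case by auto
next
  case (insert a S)
  then obtain C where C: "finite C" "B \<subseteq> C" "orthonormal g C" "span C = span (B \<union> S)"
    by blast
  have bil: "bilinear g" and sym: "\<And>x y. g x y = g y x" and pos: "\<And>x. x \<noteq> 0 \<Longrightarrow> g x x > 0"
    using g by (auto simp: inner_product_def)
  have span_eq: "span (B \<union> insert a S) = span (insert a C)"
    using C(4) by (simp add: span_insert)
  define p where "p = (\<Sum>b\<in>C. g a b *\<^sub>R b)"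
  have p: "p \<in> span C"
    unfolding p_def by (intro span_sum span_scale span_base)
  show ?case
  proof (cases "a \<in> span C")
    case True
    then show ?thesis using C span_eq span_redundant by metis
  next
    case False
    define r where "r = a - p"
    define e where "e = (1 / sqrt (g r r)) *\<^sub>R r"
    have "r \<noteq> 0" using False p by (auto simp: r_def)
    then have r: "g r r > 0" by (rule pos)
    have "g r b = 0" if "b \<in> C" for b
      using orthonormal_coeff[OF g C(1,3) that, of "g a"]
      by (simp add: r_def p_def bilinear_lsub[OF bil])
    then have e_orth: "g e b = 0" "g b e = 0" if "b \<in> C" for b
      using that sym[of b e] by (auto simp: e_def bilinear_lmul[OF bil])
    have ee: "g e e = 1"
      using r by (simp add: e_def bilinear_lmul[OF bil] bilinear_rmul[OF bil])
    have "orthonormal g (insert e C)"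
      using C(3) e_orth ee unfolding orthonormal_def by auto
    moreover have "span (insert e C) = span (insert a C)"
    proof (rule subset_antisym; intro span_minimal subspace_span)
      have "e \<in> span (insert a C)"
        unfolding e_def r_def using p span_mono[OF subset_insertI[of C a]]
        by (intro span_scale span_diff) (auto intro: span_base)
      then show "insert e C \<subseteq> span (insert a C)" by (auto intro: span_base)
      have "a = sqrt (g r r) *\<^sub>R e + p" using r by (simp add: e_def r_def)
      also have "\<dots> \<in> span (insert e C)"
        using p span_mono[OF subset_insertI[of C e]]
        by (intro span_add span_scale) (auto intro: span_base)
      finally show "insert a C \<subseteq> span (insert e C)" by (auto intro: span_base)
    qed
    ultimately show ?thesis
      using C(1,2) span_eq by (intro exI[of _ "insert e C"]) auto
  qed
qed

text \<open>A basis adapted to \<open>u\<close>: traces over \<open>u\<close> become partial sums of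
  traces over the whole space.\<close>

lemma orthonormal_basis_exists:
  assumes g: "inner_product g" and fin: "\<exists>S::'a::real_vector set. finite S \<and> span S = UNIV"
    and u: "subspace (u :: 'a set)"
  obtains B C where "finite C" "B \<subseteq> C" "orthonormal g C" "span B = u" "span C = UNIV"
proof -
  obtain S :: "'a set" where S: "finite S" "span S = UNIV" using fin by blast
  obtain T where T: "T \<subseteq> u" "independent T" "u \<subseteq> span T"
    using maximal_independent_subset[of u] by blast
  have "finite T" using independent_span_bound[OF S(1) T(2)] S(2) by auto
  moreover have "span T = u" using T u by (simp add: span_minimal subset_antisym)
  ultimately obtain B where B: "finite B" "orthonormal g B" "span B = u"
    using orthonormal_extend[OF g, of "{}" T] by (auto simp: orthonormal_def)
  obtain C where C: "finite C" "B \<subseteq> C" "orthonormal g C" "span C = span (B \<union> S)"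
    using orthonormal_extend[OF g B(1,2) S(1)] by blast
  have "span C = UNIV" using C(4) S(2) span_mono[of S "B \<union> S"] by auto
  with B C that show thesis by blast
qed

lemma lin_trace_orthonormal:
  assumes g: "inner_product g" and C: "finite C" "orthonormal g C" "span C = UNIV"
    and f: "linear f"
  shows "lin_trace f = (\<Sum>b\<in>C. g (f b) b)"
  using lin_trace_eq[OF f C(1) orthonormal_independent[OF g C(1,2)] C(3)]
    orthonormal_representation[OF g C(1,2)] C(3) by simp

section \<open>The Weyl connection\<close>

context lie_algebra
begin

lemma br_anticommute: "br x y = - br y x"
proof -
  have "br x y + br y x = br (x + y) (x + y)"
    by (simp add: bilinear_ladd[OF bilinear_br] bilinear_radd[OF bilinear_br]
        br_self[of x] br_self[of y])
  also have "\<dots> = 0" by (rule br_self)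
  finally show ?thesis by (simp add: eq_neg_iff_add_eq_0)
qed

lemma weyl_connection_inner:
  assumes g: "inner_product g" and \<theta>: "linear \<theta>"
  shows "g (weyl_connection br g \<theta> x y) z =
    (1/2) * (g (br x y) z - g (br x z) y - g (br y z) x)
      + \<theta> x * g y z + \<theta> y * g x z - g x y * \<theta> z"
proof -
  have bil: "bilinear g" using g by (simp add: inner_product_def)
  show ?thesis
    unfolding weyl_connection_def
    by (simp add: bilinear_ladd[OF bil] bilinear_lsub[OF bil] bilinear_lmul[OF bil]
        levi_civita_eq[OF g] sharp_eq[OF finite_dim g \<theta>])
qed

text \<open>The Levi-Civita part is skew, and so is \<theta>(y)x - g(x,y)\<theta>^sharp as an
  endomorphism in y; only the scalar \<theta>(x) survives symmetrization.\<close>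

lemma weyl_connection_conformal:
  assumes g: "inner_product g" and \<theta>: "linear \<theta>"
  shows "g (weyl_connection br g \<theta> x y) z + g y (weyl_connection br g \<theta> x z) =
    2 * \<theta> x * g y z"
proof -
  have sym: "\<And>a b. g a b = g b a" and bil: "bilinear g"
    using g by (auto simp: inner_product_def)
  have "g (br y z) x = - g (br z y) x"
    using br_anticommute[of y z] by (simp add: bilinear_lneg[OF bil])
  then show ?thesis
    using sym[of y "weyl_connection br g \<theta> x z"] sym[of y z]
    by (simp add: weyl_connection_inner[OF g \<theta>] algebra_simps)
qed

text \<open>The terms added to the Levi-Civita connection are symmetric in \<open>x\<close> and
  \<open>y\<close>, so they create no torsion.\<close>

lemma weyl_connection_torsion_free:
  assumes g: "inner_product g" and \<theta>: "linear \<theta>"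
  shows "weyl_connection br g \<theta> x y - weyl_connection br g \<theta> y x = br x y"
proof (rule inner_product_eqI[OF g])
  fix z
  have sym: "\<And>a b. g a b = g b a" and bil: "bilinear g"
    using g by (auto simp: inner_product_def)
  have "g (br y x) z = - g (br x y) z"
    using br_anticommute[of y x] by (simp add: bilinear_lneg[OF bil])
  then show "g (weyl_connection br g \<theta> x y - weyl_connection br g \<theta> y x) z = g (br x y) z"
    using sym[of x y]
    by (simp add: bilinear_lsub[OF bil] weyl_connection_inner[OF g \<theta>] algebra_simps)
qed

section \<open>The trace identities on a flat subspace\<close>

text \<open>By torsion-freeness, ad x is D_x minus the map sending y to D_y x. The first has trace n
  \<theta>(x), and the second takes its values in \<open>span B\<close>.\<close>

lemma lin_trace_br_flat:
  assumes g: "inner_product g" and \<theta>: "linear \<theta>"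
    and C: "finite C" "orthonormal g C" "span C = UNIV" and BC: "B \<subseteq> C"
    and inv: "\<And>y w. w \<in> span B \<Longrightarrow> weyl_connection br g \<theta> y w \<in> span B"
    and x: "x \<in> span B"
  shows "lin_trace (br x) = real (card C) * \<theta> x - (\<Sum>b\<in>B. g (weyl_connection br g \<theta> b x) b)"
proof -
  let ?D = "weyl_connection br g \<theta>"
  have bil: "bilinear g" and sym: "\<And>a b. g a b = g b a"
    using g by (auto simp: inner_product_def)
  have B: "finite B" "orthonormal g B"
    using BC C finite_subset orthonormal_subset by blast+
  have diag: "g (?D x b) b = \<theta> x" if "b \<in> C" for b
    using weyl_connection_conformal[OF g \<theta>, of x b b] sym[of b "?D x b"] that C(2)
    by (simp add: orthonormal_def)
  have "linear (br x)" using bilinear_br by (simp add: bilinear_def)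
  then have "lin_trace (br x) = (\<Sum>b\<in>C. g (br x b) b)"
    by (rule lin_trace_orthonormal[OF g C])
  also have "\<dots> = (\<Sum>b\<in>C. \<theta> x - g (?D b x) b)"
    by (simp add: weyl_connection_torsion_free[OF g \<theta>, symmetric] bilinear_lsub[OF bil] diag)
  also have "\<dots> = real (card C) * \<theta> x - (\<Sum>b\<in>C. g (?D b x) b)"
    by (simp add: sum_subtractf)
  \<comment> \<open>Vectors of \<open>C - B\<close> are orthogonal to \<open>span B\<close>, which
    contains every \<open>?D b x\<close>.\<close>
  also have "(\<Sum>b\<in>C. g (?D b x) b) = (\<Sum>b\<in>B. g (?D b x) b)"
  proof (rule sum.mono_neutral_right[OF C(1) BC], intro ballI)
    fix b assume b: "b \<in> C - B"
    have "g b (?D b x) = (\<Sum>a\<in>B. g b a * g (?D b x) a)"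
      by (rule orthonormal_parseval[OF g B inv[OF x]])
    also have "\<dots> = 0" using b BC C(2) by (intro sum.neutral) (auto simp: orthonormal_def)
    finally show "g (?D b x) b = 0" using sym by simp
  qed
  finally show ?thesis .
qed

text \<open>With A the skew part of D_t, flatness and torsion-freeness give
  \<open>R\<^sub>z = R\<^sub>t\<^sup>2 + [A, R\<^sub>t]\<close> on \<open>span B\<close> for z = D_t
  t. The commutator has trace 0, and symmetry of \<open>R\<^sub>t\<close> turns the trace of its
  square into the sum on the right.\<close>

lemma flat_trace_square:
  assumes g: "inner_product g" and \<theta>: "closed_form br \<theta>"
    and flat: "flat_subspace br g \<theta> (span B)"
    and B: "finite B" "orthonormal g B"
    and t: "t \<in> span B" "\<And>z. z \<in> span B \<Longrightarrow> g t z = \<theta> z"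
  shows "(\<Sum>b\<in>B. g (weyl_connection br g \<theta> b (weyl_connection br g \<theta> t t)) b) =
    (\<Sum>b\<in>B. g (weyl_connection br g \<theta> b t) (weyl_connection br g \<theta> b t))"
proof -
  define D where "D = weyl_connection br g \<theta>"
  have lin: "linear \<theta>" and \<theta>br: "\<theta> (br x y) = 0" for x y
    using \<theta> by (auto simp: closed_form_def derived_algebra_def intro: span_base)
  have bil: "bilinear g" and sym: "\<And>a b. g a b = g b a"
    using g by (auto simp: inner_product_def)
  note rules = bilinear_ladd[OF bil] bilinear_radd[OF bil] bilinear_lmul[OF bil]
    bilinear_rmul[OF bil] bilinear_lsub[OF bil] bilinear_rsub[OF bil]
  have inv: "D x w \<in> span B" if "w \<in> span B" for x w
    using flat that by (simp add: D_def flat_subspace_def lie_rep_on_def)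
  have curv: "D (br x y) w = D x (D y w) - D y (D x w)" if "w \<in> span B" for x y w
    using flat that by (simp add: D_def flat_subspace_def lie_rep_on_def)
  have addl: "D (x + y) w = D x w + D y w" and scalel: "D (k *\<^sub>R x) w = k *\<^sub>R D x w"
    if "w \<in> span B" for x y w k
    using flat that by (simp_all add: D_def flat_subspace_def lie_rep_on_def)
  have diffl: "D (x - y) w = D x w - D y w" if "w \<in> span B" for x y w
    using addl[OF that, of x "(-1) *\<^sub>R y"] scalel[OF that, of "-1" y] by simp
  have conf: "g (D x y) z + g y (D x z) = 2 * \<theta> x * g y z" for x y z
    unfolding D_def by (rule weyl_connection_conformal[OF g lin])
  have tors: "D x y - D y x = br x y" for x y
    unfolding D_def by (rule weyl_connection_torsion_free[OF g lin])
  \<comment> \<open>Closedness enters here: \<theta> kills [y,z], so \<theta>(D_y z) is symmetric in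
    y and z. Conformality, with g(t,.) replaced by \<theta> on \<open>span B\<close>, carries this
    over to g(D_y t, z).\<close>
  have Rsym: "g (D y t) z = g y (D z t)" if y: "y \<in> span B" and z: "z \<in> span B" for y z
  proof -
    have "\<theta> (D y z) = \<theta> (D z y)"
      using \<theta>br[of y z] by (simp add: tors[symmetric] linear_diff[OF lin])
    then show ?thesis
      using conf[of y t z] conf[of z t y] t(2)[OF y] t(2)[OF z] t(2)[OF inv[OF z, of y]]
        t(2)[OF inv[OF y, of z]] sym[of y "D z t"]
      by (simp add: mult.assoc mult.commute[of "\<theta> z" "\<theta> y"])
  qed
  define A where "A w = D t w - \<theta> t *\<^sub>R w" for w
  have A_in: "A w \<in> span B" if "w \<in> span B" for w
    unfolding A_def using that by (intro span_diff span_scale inv)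
  have Askew: "g (A v) w = - g v (A w)" for v w
    using conf[of t v w] by (simp add: A_def rules)
  have R_in: "D b t \<in> span B" for b by (rule inv[OF t(1)])
  \<comment> \<open>The trace of a symmetric times a skew endomorphism: exchanging the two summation
    indices changes the sign.\<close>
  have RA: "(\<Sum>b\<in>B. g (D b t) (A b)) = 0"
  proof -
    have "(\<Sum>b\<in>B. g (D b t) (A b)) = (\<Sum>b\<in>B. \<Sum>a\<in>B. g (D b t) a * g (A b) a)"
      by (intro sum.cong refl orthonormal_parseval[OF g B] A_in span_base)
    also have "\<dots> = (\<Sum>b\<in>B. \<Sum>a\<in>B. - (g (D a t) b * g (A a) b))"
    proof (intro sum.cong refl)
      fix a b assume "a \<in> B" "b \<in> B"
      then show "g (D b t) a * g (A b) a = - (g (D a t) b * g (A a) b)"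
        using Rsym[of b a] Askew[of b a] sym[of b "D a t"] sym[of b "A a"]
        by (simp add: span_base)
    qed
    also have "\<dots> = - (\<Sum>a\<in>B. \<Sum>b\<in>B. g (D a t) b * g (A a) b)"
      by (subst sum.swap) (simp add: sum_negf)
    also have "\<dots> = - (\<Sum>b\<in>B. g (D b t) (A b))"
      by (intro arg_cong[of _ _ uminus] sum.cong refl orthonormal_parseval[OF g B, symmetric]
          A_in span_base)
    finally show ?thesis by simp
  qed
  have "g (D b (D t t)) b = g (D b t) (D b t) - 2 * g (D b t) (A b)" if "b \<in> B" for b
  proof -
    have b: "b \<in> span B" using that by (rule span_base)
    \<comment> \<open>Flatness enters here, through \<open>curv\<close>; torsion-freeness then
      resolves the bracket.\<close>
    have "D b (D t t) = D t (D b t) + D (br b t) t"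
      using curv[OF t(1), of b t] by simp
    also have "D (br b t) t = D (D b t) t - D (D t b) t"
      by (simp add: tors[symmetric] diffl[OF t(1)])
    also have "D (D t b) t = D (A b) t + \<theta> t *\<^sub>R D b t"
      by (simp add: A_def diffl[OF t(1)] scalel[OF t(1)])
    finally have "D b (D t t) = A (D b t) + D (D b t) t - D (A b) t"
      by (simp add: A_def)
    moreover have "g (A (D b t)) b = - g (D b t) (A b)" by (rule Askew)
    moreover have "g (D (D b t) t) b = g (D b t) (D b t)" by (rule Rsym[OF R_in b])
    moreover have "g (D (A b) t) b = g (D b t) (A b)"
      using Rsym[OF A_in[OF b] b] sym by simp
    ultimately show ?thesis by (simp add: rules)
  qed
  then have "(\<Sum>b\<in>B. g (D b (D t t)) b) = (\<Sum>b\<in>B. g (D b t) (D b t))"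
    using RA by (simp add: sum_subtractf flip: sum_distrib_left)
  then show ?thesis by (simp add: D_def)
qed

end

theorem theorem4p2:
  fixes br :: "'a::real_vector \<Rightarrow> 'a \<Rightarrow> 'a"
    and g :: "'a \<Rightarrow> 'a \<Rightarrow> real"
    and \<theta> :: "'a \<Rightarrow> real"
    and u :: "'a set"
  assumes "lie_algebra br"
    and "unimodular br"
    and "proper_LCP br g \<theta> u"
  shows "adapted_LCP br g \<theta> u"
proof -
  interpret lie_algebra br by fact
  let ?D = "weyl_connection br g \<theta>"
  have lcp: "LCP_structure br g \<theta> u" and proper: "u \<noteq> UNIV"
    using assms(3) by (auto simp: proper_LCP_def)
  have g: "inner_product g" and \<theta>: "closed_form br \<theta>" and flat: "flat_subspace br g \<theta> u"
    using lcp by (auto simp: LCP_structure_def)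
  have lin: "linear \<theta>" using \<theta> by (simp add: closed_form_def)
  have sub: "subspace u" and inv: "\<And>x w. w \<in> u \<Longrightarrow> ?D x w \<in> u"
    using flat by (auto simp: flat_subspace_def lie_rep_on_def)
  have sym: "\<And>a b. g a b = g b a" and pos: "\<And>x. x \<noteq> 0 \<Longrightarrow> g x x > 0"
    using g by (auto simp: inner_product_def)
  obtain B C where C: "finite C" "B \<subseteq> C" "orthonormal g C" and B_span: "span B = u"
    and C_span: "span C = UNIV"
    using orthonormal_basis_exists[OF g finite_dim sub] .
  have B: "finite B" "orthonormal g B"
    using C finite_subset orthonormal_subset by blast+
  \<comment> \<open>The only use of properness; the strict inequality of dimensions yields the final
    contradiction.\<close>
  have "B \<noteq> C" using B_span C_span proper by auto
  then have card_less: "card B < card C" using C(1,2) by (simp add: psubset_card_mono psubsetI)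
  obtain t where t: "t \<in> u" "\<And>z. z \<in> u \<Longrightarrow> g t z = \<theta> z"
    using riesz_on_span[OF g B(1) lin] B_span by auto
  \<comment> \<open>Unimodularity makes the left side of \<open>lin_trace_br_flat\<close>
    vanish.\<close>
  have tr: "(\<Sum>b\<in>B. g (?D b x) b) = real (card C) * \<theta> x" if "x \<in> u" for x
    using lin_trace_br_flat[OF g lin C(1,3) C_span C(2), of x] that inv B_span assms(2)
    by (simp add: unimodular_def)
  \<comment> \<open>Conformality at (t,t,t), where both g(t,t) and g(t, D_t t) are values of
    \<theta>.\<close>
  have \<theta>tt: "\<theta> (?D t t) = (\<theta> t)\<^sup>2"
    using weyl_connection_conformal[OF g lin, of t t t] sym[of t "?D t t"] t inv
    by (simp add: power2_eq_square)
  have "(real (card C) * \<theta> t)\<^sup>2 = (\<Sum>b\<in>B. 1 * g (?D b t) b)\<^sup>2"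
    using tr[OF t(1)] by simp
  \<comment> \<open>Pairing the diagonal of \<open>R\<^sub>t\<close> with the constant vector 1
    produces the factor dim u.\<close>
  also have "\<dots> \<le> (\<Sum>b\<in>B. 1\<^sup>2) * (\<Sum>b\<in>B. (g (?D b t) b)\<^sup>2)"
    by (rule Cauchy_Schwarz_ineq_sum)
  \<comment> \<open>Each squared diagonal entry is one term of the Parseval sum for the squared norm
    of \<open>?D b t\<close>.\<close>
  also have "\<dots> \<le> (\<Sum>b\<in>B. 1\<^sup>2) * (\<Sum>b\<in>B. g (?D b t) (?D b t))"
  proof (intro mult_left_mono sum_mono)
    fix b assume b: "b \<in> B"
    have "(g (?D b t) b)\<^sup>2 \<le> (\<Sum>a\<in>B. (g (?D b t) a)\<^sup>2)"
      by (rule member_le_sum[OF b]) (use B(1) in auto)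
    also have "\<dots> = g (?D b t) (?D b t)"
      using orthonormal_parseval[OF g B, of "?D b t" "?D b t"] inv[OF t(1)] B_span
      by (simp add: power2_eq_square)
    finally show "(g (?D b t) b)\<^sup>2 \<le> g (?D b t) (?D b t)" .
  qed (simp add: sum_nonneg)
  \<comment> \<open>The sum of squared norms is the trace of \<open>R\<^sub>z\<close> for z = D_t t,
    hence n \<theta>(z) by \<open>tr\<close>.\<close>
  also have "\<dots> = real (card B) * (real (card C) * (\<theta> t)\<^sup>2)"
    using flat_trace_square[OF g \<theta> _ B, of t] flat t B_span tr[OF inv[OF t(1)]] \<theta>tt by simp
  finally have le: "real (card C) * (real (card C) * (\<theta> t)\<^sup>2)
      \<le> real (card B) * (real (card C) * (\<theta> t)\<^sup>2)"
    by (simp add: power_mult_distrib power2_eq_square mult_ac)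
  have "\<theta> t = 0"
  proof (rule ccontr)
    assume "\<theta> t \<noteq> 0"
    then have "real (card C) * (\<theta> t)\<^sup>2 > 0" using card_less by simp
    with le have "real (card C) \<le> real (card B)" by (simp only: mult_le_cancel_right_pos)
    with card_less show False by simp
  qed
  \<comment> \<open>Here g(t,t) = \<theta>(t) = 0, and \<open>t\<close> represents \<theta> on
    \<open>u\<close>.\<close>
  then have "t = 0" using t pos[of t] by fastforce
  then have "\<theta> w = 0" if "w \<in> u" for w
    using t(2)[OF that] g by (simp add: inner_product_def bilinear_lzero)
  with lcp show ?thesis by (simp add: adapted_LCP_def)
qed

end
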